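(* Let $\mathcal{M}$ be a countable MDP (possibly infinitely branching) with real-valued transition rewards and initial state $s_0$, and consider the objective $\mathit{PP}_{\liminf\ge 0}=\{\rho \mid \liminf_{n\to\infty} r(e_n)\ge 0\}$. For every $\varepsilon>0$: (1) there exists a memoryless deterministic (MD) strategy in $S(\mathcal{M})$ that is $\varepsilon$-optimal for $\mathit{PP}_{\liminf\ge 0}$ from $(s_0,0)$; (2) there exists a deterministic Markov strategy in $\mathcal{M}$ that is $\varepsilon$-optimal for $\mathit{PP}_{\liminf\ge 0}$ from $s_0$.
   Context: A countable MDP $\mathcal{M}=(S,S_\Box,S_\circ,\to,P,r)$ consists of a countable set $S$ of states partitioned into controlled states $S_\Box$ and random states $S_\circ$, a transition relation ${\to}\subseteq S\times S$ in which every state has a successor, a function $P$ giving each random state a probability distribution over its successors, and rewards $r:{\to}\to\mathbb{R}$. A run is $s_0e_0s_1e_1\dots$ with $e_i=(s_i,s_{i+1})\in{\to}$. A strategy assigns to each finite partial run ending in a controlled state a distribution over that state's successors, inducing a probability measure $\mathcal{P}_{\mathcal{M},s_0,\sigma}$ on runs. The value of $\varphi$ at $s$ is $\sup_\sigma \mathcal{P}_{\mathcal{M},s,\sigma}(\varphi)$, and $\sigma$ is $\varepsilon$-optimal from $s$ if it attains at least value$-\varepsilon$. MD strategies choose Dirac distributions depending only on the current state. A Markov (step counter) strategy bases its choice only on the current state and the number of steps taken so far; it is deterministic if all choices are Dirac. The MDP $S(\mathcal{M})$ encodes the step counter: its states are pairs $(s,n)$ with $s\in S$, $n\in\mathbb{N}$;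 $(s,n)$ is controlled iff $s$ is; there is a transition $(s,n)\to(s',n+1)$ iff $s\to s'$ in $\mathcal{M}$, with reward $r(s\to s')$; for random $(s,n)$ the probability of moving to $(s',n+1)$ is $P(s)(s')$. *)

theory Defs
  imports "HOL-Probability.Probability"
begin

section \<open>Countable Markov decision processes\<close>

record 's mdp =
  states :: "'s set"
  controlled :: "'s set"
  random_states :: "'s set"
  edges :: "('s \<times> 's) set"
  step_prob :: "'s \<Rightarrow> 's pmf"
  reward :: "'s \<times> 's \<Rightarrow> real"

text \<open>The fields \<open>step_prob\<close> and \<open>reward\<close> are total functions, but only their values on random
  states and on edges, respectively, carry meaning. Infinite branching is allowed.\<close>

definition countable_mdp :: "'s mdp \<Rightarrow> bool" where
  "countable_mdp M \<longleftrightarrow>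
     countable (states M) \<and>
     states M = controlled M \<union> random_states M \<and>
     controlled M \<inter> random_states M = {} \<and>
     edges M \<subseteq> states M \<times> states M \<and>
     (\<forall>s\<in>states M. \<exists>t. (s, t) \<in> edges M) \<and>
     (\<forall>s\<in>random_states M. set_pmf (step_prob M s) \<subseteq> {t. (s, t) \<in> edges M})"


section \<open>Runs and strategies\<close>

text \<open>A run \<open>s\<^sub>0 e\<^sub>0 s\<^sub>1 e\<^sub>1 \<dots>\<close> is determined by its states, since \<open>e\<^sub>i = (s\<^sub>i, s\<^sub>i\<^sub>+\<^sub>1)\<close>; runs and partial
  runs are therefore represented by their state sequences.\<close>

definition runs :: "'s mdp \<Rightarrow> (nat \<Rightarrow> 's) set" where
  "runs M = {\<rho>. \<forall>n. \<rho> n \<in> states M \<and> (\<rho> n, \<rho> (Suc n)) \<in> edges M}"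

definition partial_run :: "'s mdp \<Rightarrow> 's list \<Rightarrow> bool" where
  "partial_run M h \<longleftrightarrow>
     h \<noteq> [] \<and> set h \<subseteq> states M \<and> (\<forall>i. Suc i < length h \<longrightarrow> (h ! i, h ! Suc i) \<in> edges M)"

definition strategy :: "'s mdp \<Rightarrow> ('s list \<Rightarrow> 's pmf) \<Rightarrow> bool" where
  "strategy M \<sigma> \<longleftrightarrow>
     (\<forall>h. partial_run M h \<and> last h \<in> controlled M \<longrightarrow> set_pmf (\<sigma> h) \<subseteq> {t. (last h, t) \<in> edges M})"

definition MD_strategy :: "'s mdp \<Rightarrow> ('s list \<Rightarrow> 's pmf) \<Rightarrow> bool" where
  "MD_strategy M \<sigma> \<longleftrightarrow> strategy M \<sigma> \<and>
     (\<exists>f. \<forall>h. partial_run M h \<and> last h \<in> controlled M \<longrightarrow> \<sigma> h = return_pmf (f (last h)))"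

text \<open>A partial run with \<open>k + 1\<close> states has taken \<open>k\<close> steps.\<close>

definition det_Markov_strategy :: "'s mdp \<Rightarrow> ('s list \<Rightarrow> 's pmf) \<Rightarrow> bool" where
  "det_Markov_strategy M \<sigma> \<longleftrightarrow> strategy M \<sigma> \<and>
     (\<exists>f. \<forall>h. partial_run M h \<and> last h \<in> controlled M \<longrightarrow>
        \<sigma> h = return_pmf (f (length h - 1) (last h)))"


section \<open>The probability measure induced by a strategy\<close>

definition next_distr :: "'s mdp \<Rightarrow> ('s list \<Rightarrow> 's pmf) \<Rightarrow> 's list \<Rightarrow> 's pmf" where
  "next_distr M \<sigma> h = (if last h \<in> controlled M then \<sigma> h else step_prob M (last h))"

text \<open>The distribution of the state at time \<open>n\<close>, given the states \<open>\<omega> 0, \<dots>, \<omega> (n - 1)\<close>. For \<open>n = 0\<close>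
  it is the point mass at the initial state. Its value on nonempty histories that are not partial
  runs is irrelevant, because such histories have probability 0 under a strategy; it is chosen
  constant there in order to be measurable even when the type \<open>'s\<close> is uncountable.\<close>

definition step_kernel ::
    "'s mdp \<Rightarrow> ('s list \<Rightarrow> 's pmf) \<Rightarrow> 's \<Rightarrow> nat \<Rightarrow> (nat \<Rightarrow> 's) \<Rightarrow> 's measure" where
  "step_kernel M \<sigma> s n \<omega> = measure_pmf
     (if partial_run M (map \<omega> [0..<n]) then next_distr M \<sigma> (map \<omega> [0..<n]) else return_pmf s)"

text \<open>The Ionescu-Tulcea measure of these kernels, on the product \<open>\<sigma>\<close>-algebra over the discrete
  \<open>\<sigma>\<close>-algebra on states. The lemmas \<open>emeasure_run_measure_cylinder\<close> and \<open>AE_runs\<close> below confirm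
  that it gives the cylinders the expected probabilities and that it is concentrated on runs.\<close>

definition run_measure :: "'s mdp \<Rightarrow> ('s list \<Rightarrow> 's pmf) \<Rightarrow> 's \<Rightarrow> (nat \<Rightarrow> 's) measure" where
  "run_measure M \<sigma> s =
     projective_family.lim UNIV
       (Ionescu_Tulcea.CI (step_kernel M \<sigma> s) (\<lambda>_. count_space UNIV)) (\<lambda>_. count_space UNIV)"


section \<open>Objectives, values and near-optimal strategies\<close>

definition value_of :: "'s mdp \<Rightarrow> (nat \<Rightarrow> 's) set \<Rightarrow> 's \<Rightarrow> real" where
  "value_of M \<phi> s = (SUP \<sigma>\<in>{\<sigma>. strategy M \<sigma>}. measure (run_measure M \<sigma> s) \<phi>)"

definition eps_optimal ::
    "'s mdp \<Rightarrow> (nat \<Rightarrow> 's) set \<Rightarrow> 's \<Rightarrow> real \<Rightarrow> ('s list \<Rightarrow> 's pmf) \<Rightarrow> bool" where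
  "eps_optimal M \<phi> s \<epsilon> \<sigma> \<longleftrightarrow>
     strategy M \<sigma> \<and> measure (run_measure M \<sigma> s) \<phi> \<ge> value_of M \<phi> s - \<epsilon>"

definition PP_liminf_nonneg :: "'s mdp \<Rightarrow> (nat \<Rightarrow> 's) set" where
  "PP_liminf_nonneg M = {\<rho> \<in> runs M. liminf (\<lambda>n. ereal (reward M (\<rho> n, \<rho> (Suc n)))) \<ge> 0}"


section \<open>Encoding the step counter into the states\<close>

definition step_counter_mdp :: "'s mdp \<Rightarrow> ('s \<times> nat) mdp" where
  "step_counter_mdp M =
     \<lparr>states = states M \<times> UNIV,
      controlled = controlled M \<times> UNIV,
      random_states = random_states M \<times> UNIV,
      edges = {((s, n), (t, Suc n)) | s t n. (s, t) \<in> edges M},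
      step_prob = (\<lambda>(s, n). map_pmf (\<lambda>t. (t, Suc n)) (step_prob M s)),
      reward = (\<lambda>((s, _), (t, _)). reward M (s, t))\<rparr>"


section \<open>Well-definedness\<close>

lemma countable_mdp_step_counter: "countable_mdp M \<Longrightarrow> countable_mdp (step_counter_mdp M)"
  unfolding countable_mdp_def step_counter_mdp_def by (auto; blast)

lemma strategy_exists:
  assumes "countable_mdp M"
  shows "\<exists>\<sigma>. strategy M \<sigma>"
proof -
  have "\<forall>s. \<exists>t. s \<in> states M \<longrightarrow> (s, t) \<in> edges M"
    using assms unfolding countable_mdp_def by blast
  then obtain f where f: "\<And>s. s \<in> states M \<Longrightarrow> (s, f s) \<in> edges M"
    by metis
  have "strategy M (\<lambda>h. return_pmf (f (last h)))"
    using assms f unfolding strategy_def countable_mdp_def by auto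
  then show ?thesis by blast
qed

lemma measurable_step_kernel:
  assumes "countable (states M)"
  shows "step_kernel M \<sigma> s n \<in>
    measurable (PiM {0..<n} (\<lambda>_. count_space UNIV)) (subprob_algebra (count_space UNIV))"
proof -
  let ?P = "PiM {0..<n} (\<lambda>_. count_space (UNIV :: 'a set))"
  define X where "X = {\<omega> \<in> space ?P. partial_run M (map \<omega> [0..<n])}"
  have inj: "inj_on (\<lambda>\<omega>. map \<omega> [0..<n]) X"
  proof (rule inj_onI)
    fix x y assume "x \<in> X" "y \<in> X" "map x [0..<n] = map y [0..<n]"
    then show "x = y"
      unfolding X_def space_PiM by (intro PiE_ext[of x "{0..<n}" "\<lambda>_. UNIV" y]) auto
  qed
  have "(\<lambda>\<omega>. map \<omega> [0..<n]) ` X \<subseteq> lists (states M)"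
    unfolding X_def partial_run_def by (auto simp: lists_eq_set)
  then have X: "countable X"
    using inj assms by (meson countable_image_inj_on countable_lists countable_subset)
  have sub: "measure_pmf p \<in> space (subprob_algebra (count_space UNIV))" for p :: "'a pmf"
    by (simp add: space_subprob_algebra prob_space_imp_subprob_space prob_space_measure_pmf)
  show ?thesis
  proof (rule measurable_restrict_countable[OF X])
    fix x assume "x \<in> X"
    then have x: "x \<in> extensional {0..<n}"
      by (auto simp: X_def space_PiM PiE_def)
    have "{x} = PiE {0..<n} (\<lambda>i. {x i})"
      using x by (simp add: PiE_singleton)
    then show "{x} \<in> sets ?P"
      by (metis sets_PiM_I_finite finite_atLeastLessThan sets_count_space Pow_UNIV UNIV_I)
  next
    fix x assume "x \<in> X"
    then show "step_kernel M \<sigma> s n x \<in> space (subprob_algebra (count_space UNIV))"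
      by (simp only: step_kernel_def sub)
  next
    have "(\<lambda>x. measure_pmf (return_pmf s)) \<in>
        measurable (restrict_space ?P (- X)) (subprob_algebra (count_space UNIV))"
      by (rule measurable_const[OF sub])
    then show "step_kernel M \<sigma> s n \<in>
        measurable (restrict_space ?P (- X)) (subprob_algebra (count_space UNIV))"
      by (rule measurable_cong[THEN iffD1, rotated])
         (auto simp: step_kernel_def X_def space_restrict_space)
  qed
qed

lemma Ionescu_Tulcea_step_kernel:
  assumes "countable (states M)"
  shows "Ionescu_Tulcea (step_kernel M \<sigma> s) (\<lambda>_. count_space UNIV)"
proof (rule Ionescu_Tulcea.intro)
  show "step_kernel M \<sigma> s i \<in>
      measurable (PiM {0..<i} (\<lambda>_. count_space UNIV)) (subprob_algebra (count_space UNIV))" for i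
    by (rule measurable_step_kernel[OF assms])
  show "prob_space (step_kernel M \<sigma> s i x)" for i x
    unfolding step_kernel_def by (rule prob_space_measure_pmf)
qed

lemma sets_run_measure:
  assumes "countable (states M)"
  shows "sets (run_measure M \<sigma> s) = sets (PiM UNIV (\<lambda>_. count_space UNIV))"
proof -
  interpret Ionescu_Tulcea "step_kernel M \<sigma> s" "\<lambda>_. count_space UNIV"
    by (rule Ionescu_Tulcea_step_kernel[OF assms])
  show ?thesis by (simp add: run_measure_def)
qed

lemma space_run_measure:
  assumes "countable (states M)"
  shows "space (run_measure M \<sigma> s) = UNIV"
  using sets_eq_imp_space_eq[OF sets_run_measure[OF assms, of \<sigma> s]] by (simp add: space_PiM)

lemma prob_space_run_measure:
  assumes "countable (states M)"
  shows "prob_space (run_measure M \<sigma> s)"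
proof -
  interpret Ionescu_Tulcea "step_kernel M \<sigma> s" "\<lambda>_. count_space UNIV"
    by (rule Ionescu_Tulcea_step_kernel[OF assms])
  have "prob_space (distr PF.lim (PiM {} (\<lambda>_. count_space UNIV)) (\<lambda>x. restrict x {}))"
    by (subst distr_lim) (auto intro: PF.prob_space_P)
  then have "prob_space PF.lim"
    by (rule prob_space_distrD[rotated])
       (simp add: measurable_cong_sets[OF PF.sets_lim refl] measurable_restrict_subset)
  then show ?thesis
    unfolding run_measure_def .
qed

lemma map_upt_eq_iff: "map \<omega> [0..<length h] = h \<longleftrightarrow> (\<forall>i<length h. \<omega> i = h ! i)"
  by (subst list_eq_iff_nth_eq) simp

lemma emeasure_run_measure_step:
  assumes "countable (states M)"
  shows "emeasure (run_measure M \<sigma> s) {\<omega>. map \<omega> [0..<length h] = h \<and> \<omega> (length h) \<in> T} =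
    emeasure (run_measure M \<sigma> s) {\<omega>. map \<omega> [0..<length h] = h} *
    emeasure (measure_pmf (if partial_run M h then next_distr M \<sigma> h else return_pmf s)) T"
proof -
  interpret IT: Ionescu_Tulcea "step_kernel M \<sigma> s" "\<lambda>_. count_space UNIV"
    by (rule Ionescu_Tulcea_step_kernel[OF assms])
  let ?n = "length h"
  let ?PM = "\<lambda>J. PiM J (\<lambda>_::nat. count_space (UNIV :: 'a set))"
  let ?C = "IT.C 0"
  let ?u = "\<lambda>_::nat. undefined :: 'a"
  define A where "A = PiE {0..<?n} (\<lambda>i. {h ! i})"
  define B where "B = PiE {0..<Suc ?n} (\<lambda>i. if i < ?n then {h ! i} else T)"
  let ?K = "emeasure (measure_pmf (if partial_run M h then next_distr M \<sigma> h else return_pmf s)) T"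
  have A[measurable]: "A \<in> sets (?PM {0..<?n})"
    unfolding A_def by (rule sets_PiM_I_finite) auto
  have B[measurable]: "B \<in> sets (?PM {0..<Suc ?n})"
    unfolding B_def by (rule sets_PiM_I_finite) auto
  have lim: "emeasure (run_measure M \<sigma> s) (prod_emb UNIV (\<lambda>_. count_space UNIV) {0..<m} X) =
      emeasure (?C m ?u) X" if X: "X \<in> sets (?PM {0..<m})" for m X
  proof -
    have "emeasure (IT.CI {0..<m}) X =
        emeasure (?C m ?u) (prod_emb {0..<m} (\<lambda>_. count_space UNIV) {0..<m} X)"
      by (rule IT.emeasure_CI[OF _ X]) simp
    moreover have "prod_emb {0..<m} (\<lambda>_. count_space UNIV) {0..<m} X = X"
      using sets.sets_into_space[OF X] by (intro prod_emb_id) (auto simp: space_PiM)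
    ultimately show ?thesis
      unfolding run_measure_def using IT.lim[OF _ X] by simp
  qed
  have embA: "prod_emb UNIV (\<lambda>_. count_space UNIV) {0..<?n} A =
      {\<omega>. map \<omega> [0..<?n] = h}"
    by (auto simp: A_def prod_emb_def space_PiM PiE_iff map_upt_eq_iff)
  have embB: "prod_emb UNIV (\<lambda>_. count_space UNIV) {0..<Suc ?n} B =
      {\<omega>. map \<omega> [0..<?n] = h \<and> \<omega> ?n \<in> T}"
    by (auto simp: B_def prod_emb_def space_PiM PiE_iff map_upt_eq_iff less_Suc_eq split: if_splits)
  have spC: "space (?C ?n ?u) = space (?PM {0..<?n})"
    using IT.space_C[of ?u 0 ?n] by simp
  have setC: "sets (?C ?n ?u) = sets (?PM {0..<?n})"
    using IT.sets_C[of ?u 0 ?n] by simp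
  have eP: "emeasure (IT.eP ?n \<omega>) B = ?K * indicator A \<omega>" if \<omega>: "\<omega> \<in> space (?PM {0..<?n})" for \<omega>
  proof -
    have "emeasure (IT.eP ?n \<omega>) B =
        emeasure (step_kernel M \<sigma> s ?n \<omega>) ((\<lambda>x. fun_upd \<omega> ?n x) -` B \<inter> space (count_space UNIV))"
      by (rule IT.emeasure_eP[OF \<omega> B])
    also have "(\<lambda>x. fun_upd \<omega> ?n x) -` B \<inter> space (count_space UNIV) = (if \<omega> \<in> A then T else {})"
      using \<omega> by (auto simp: A_def B_def PiE_iff space_PiM less_Suc_eq extensional_def split: if_splits)
    also have "emeasure (step_kernel M \<sigma> s ?n \<omega>) \<dots> = ?K * indicator A \<omega>"
    proof (cases "\<omega> \<in> A")
      case True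
      then have "map \<omega> [0..<?n] = h"
        by (auto simp: A_def PiE_iff map_upt_eq_iff)
      then show ?thesis using True by (simp add: step_kernel_def)
    qed simp
    finally show ?thesis .
  qed
  have "emeasure (?C (Suc ?n) ?u) B = (\<integral>\<^sup>+\<omega>. emeasure (IT.eP ?n \<omega>) B \<partial>?C ?n ?u)"
  proof -
    have "IT.eP ?n \<in> measurable (?C ?n ?u) (subprob_algebra (?PM {0..<Suc ?n}))"
      using IT.measurable_eP[of ?n] by (simp add: measurable_cong_sets[OF setC refl])
    moreover have "space (?C ?n ?u) \<noteq> {}"
      unfolding spC by (auto simp: space_PiM PiE_eq_empty_iff)
    ultimately show ?thesis
      by (simp add: emeasure_bind[OF _ _ B])
  qed
  also have "\<dots> = (\<integral>\<^sup>+\<omega>. ?K * indicator A \<omega> \<partial>?C ?n ?u)"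
    by (rule nn_integral_cong) (simp add: spC eP)
  also have "\<dots> = ?K * emeasure (?C ?n ?u) A"
    by (rule nn_integral_cmult_indicator) (simp add: setC)
  finally show ?thesis
    using lim[OF A] lim[OF B] unfolding embA embB by (simp add: mult.commute)
qed

lemma emeasure_run_measure_init:
  assumes "countable (states M)"
  shows "emeasure (run_measure M \<sigma> s) {\<omega>. \<omega> 0 = t} = (if t = s then 1 else 0)"
proof -
  interpret prob_space "run_measure M \<sigma> s"
    by (rule prob_space_run_measure[OF assms])
  show ?thesis
    using emeasure_run_measure_step[OF assms, of \<sigma> s "[]" "{t}"] emeasure_space_1
    by (simp add: space_run_measure[OF assms] partial_run_def)
qed

lemma emeasure_run_measure_cylinder:
  assumes "countable (states M)" and "partial_run M h" and "hd h = s"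
  shows "emeasure (run_measure M \<sigma> s) {\<omega>. \<forall>i<length h. \<omega> i = h ! i} =
    (\<Prod>i=1..<length h. ennreal (pmf (next_distr M \<sigma> (take i h)) (h ! i)))"
proof -
  have *: "{\<omega>. \<forall>i<length h. \<omega> i = h ! i} = {\<omega>. map \<omega> [0..<length h] = h}" for h :: "'a list"
    by (simp only: map_upt_eq_iff)
  show ?thesis
    unfolding * using assms(2,3)
  proof (induction h rule: rev_induct)
    case Nil
    then show ?case by (simp add: partial_run_def)
  next
    case (snoc t h)
    show ?case
    proof (cases "h = []")
      case True
      then show ?thesis
        using snoc.prems emeasure_run_measure_init[OF assms(1), of \<sigma> s t] by simp
    next
      case False
      have h: "partial_run M h"
        unfolding partial_run_def
      proof (intro conjI allI impI)
        show "h \<noteq> []" "set h \<subseteq> states M"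
          using False snoc.prems(1) by (auto simp: partial_run_def)
        show "(h ! i, h ! Suc i) \<in> edges M" if "Suc i < length h" for i
          using snoc.prems(1) that unfolding partial_run_def
          by (auto simp: nth_append dest!: spec[of _ i])
      qed
      have "{\<omega>. map \<omega> [0..<length (h @ [t])] = h @ [t]} =
          {\<omega>. map \<omega> [0..<length h] = h \<and> \<omega> (length h) \<in> {t}}"
        by auto
      moreover have "(\<Prod>i=1..<length (h @ [t]). ennreal (pmf (next_distr M \<sigma> (take i (h @ [t]))) ((h @ [t]) ! i))) =
          (\<Prod>i=1..<length h. ennreal (pmf (next_distr M \<sigma> (take i h)) (h ! i))) *
          ennreal (pmf (next_distr M \<sigma> h) t)"
      proof -
        have "{1..<length (h @ [t])} = insert (length h) {1..<length h}"
          using False by (cases h) auto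
        then show ?thesis
          by (simp add: mult.commute nth_append)
      qed
      moreover have "hd h = s"
        using snoc.prems(2) False by simp
      ultimately show ?thesis
        using snoc.IH[OF h] emeasure_run_measure_step[OF assms(1), of \<sigma> s h "{t}"] h
        by (simp add: emeasure_pmf_single)
    qed
  qed
qed

lemma AE_runs:
  assumes M: "countable_mdp M" and s: "s \<in> states M" and \<sigma>: "strategy M \<sigma>"
  shows "AE \<omega> in run_measure M \<sigma> s. \<omega> \<in> runs M \<and> \<omega> 0 = s"
proof -
  let ?R = "run_measure M \<sigma> s"
  have ctbl: "countable (states M)"
    using M unfolding countable_mdp_def by blast
  interpret prob_space ?R
    by (rule prob_space_run_measure[OF ctbl])
  have spR: "space ?R = UNIV" by (rule space_run_measure[OF ctbl])
  have coord: "(\<lambda>\<omega>. \<omega> i) \<in> measurable ?R (count_space UNIV)" for i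
    unfolding measurable_cong_sets[OF sets_run_measure[OF ctbl] refl]
    by (rule measurable_component_singleton) simp
  have init: "AE \<omega> in ?R. \<omega> 0 = s"
  proof -
    have "{\<omega>. \<omega> 0 = s} \<in> events"
      using measurable_sets[OF coord[of 0], of "{s}"] by (simp add: spR vimage_def)
    then show ?thesis
      using emeasure_run_measure_init[OF ctbl, of \<sigma> s s] AE_in_set_eq_1[of "{\<omega>. \<omega> 0 = s}"]
      by (simp add: emeasure_eq_measure)
  qed
  define H where "H = {h. partial_run M h}"
  have "countable H"
    by (rule countable_subset[OF _ countable_lists[OF ctbl]]) (auto simp: H_def partial_run_def)
  moreover have "AE \<omega> in ?R. \<not> (map \<omega> [0..<length h] = h \<and> \<omega> (length h) \<in> {t. (last h, t) \<notin> edges M})"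
    if h: "h \<in> H" for h
  proof -
    have run: "partial_run M h" using h by (simp add: H_def)
    have "last h \<in> states M"
      using run unfolding partial_run_def by auto
    then have "set_pmf (next_distr M \<sigma> h) \<subseteq> {t. (last h, t) \<in> edges M}"
      using M \<sigma> run unfolding next_distr_def strategy_def countable_mdp_def by (auto split: if_splits)
    then have "emeasure (measure_pmf (next_distr M \<sigma> h)) {t. (last h, t) \<notin> edges M} = 0"
      by (auto simp: measure_pmf.emeasure_eq_measure measure_pmf_zero_iff)
    then have 0: "emeasure ?R {\<omega>. map \<omega> [0..<length h] = h \<and> \<omega> (length h) \<in> {t. (last h, t) \<notin> edges M}} = 0"
      using emeasure_run_measure_step[OF ctbl, of \<sigma> s h "{t. (last h, t) \<notin> edges M}"]
      by (simp only: run if_True mult_zero_right)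
    have "{\<omega>. map \<omega> [0..<length h] = h \<and> \<omega> (length h) \<in> {t. (last h, t) \<notin> edges M}} =
        (\<Inter>i\<in>{..<length h}. (\<lambda>\<omega>. \<omega> i) -` {h ! i} \<inter> space ?R) \<inter>
        ((\<lambda>\<omega>. \<omega> (length h)) -` {t. (last h, t) \<notin> edges M} \<inter> space ?R)"
      unfolding map_upt_eq_iff spR by auto
    also have "\<dots> \<in> events"
      using run by (intro sets.Int sets.finite_INT measurable_sets[OF coord]) (auto simp: partial_run_def)
    finally show ?thesis
      by (intro AE_I[OF _ 0]) blast+
  qed
  ultimately have "AE \<omega> in ?R. \<forall>h\<in>H. \<not> (map \<omega> [0..<length h] = h \<and> \<omega> (length h) \<in> {t. (last h, t) \<notin> edges M})"
    by (subst AE_ball_countable) blast+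
  with init show ?thesis
  proof eventually_elim
    case (elim \<omega>)
    have *: "partial_run M (map \<omega> [0..<Suc n])" for n
    proof (induction n)
      case 0
      then show ?case using elim(1) s by (simp add: partial_run_def)
    next
      case (Suc n)
      let ?h = "map \<omega> [0..<Suc n]"
      have "(last ?h, \<omega> (Suc n)) \<in> edges M"
        using elim(2) Suc unfolding H_def by force
      then have e: "(\<omega> n, \<omega> (Suc n)) \<in> edges M" by simp
      then have "\<omega> (Suc n) \<in> states M"
        using M unfolding countable_mdp_def by blast
      moreover have "(\<omega> i, \<omega> (Suc i)) \<in> edges M" if "i < Suc n" for i
      proof (cases "i = n")
        case False
        then show ?thesis
          using Suc that unfolding partial_run_def
          by (auto simp del: upt_Suc dest!: spec[of _ i])
      qed (use e in simp)
      ultimately show ?case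
        using Suc unfolding partial_run_def
        by (auto simp del: upt_Suc simp: atLeastLessThanSuc)
    qed
    have "(\<omega> n, \<omega> (Suc n)) \<in> edges M" for n
      using *[of "Suc n"] unfolding partial_run_def
      by (auto simp del: upt_Suc dest!: spec[of _ n])
    then show ?case
      using elim(1) M unfolding runs_def countable_mdp_def by blast
  qed
qed

lemma PP_liminf_nonneg_measurable:
  assumes M: "countable_mdp M"
  shows "PP_liminf_nonneg M \<in> sets (run_measure M \<sigma> s)"
proof -
  let ?R = "run_measure M \<sigma> s"
  have ctbl: "countable (states M)"
    using M unfolding countable_mdp_def by blast
  have spR: "space ?R = UNIV" by (rule space_run_measure[OF ctbl])
  have coord[measurable]: "(\<lambda>\<omega>. \<omega> i) \<in> measurable ?R (count_space UNIV)" for i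
    unfolding measurable_cong_sets[OF sets_run_measure[OF ctbl] refl]
    by (rule measurable_component_singleton) simp
  have cE: "countable (edges M)"
    using M ctbl unfolding countable_mdp_def by (meson countable_SIGMA countable_subset)
  have E: "{\<omega>. (\<omega> n, \<omega> (Suc n)) \<in> A} \<in> sets ?R" if "A \<subseteq> edges M" for A n
  proof -
    have "{\<omega>. (\<omega> n, \<omega> (Suc n)) \<in> A} =
        (\<Union>e\<in>A. ((\<lambda>\<omega>. \<omega> n) -` {fst e} \<inter> space ?R) \<inter> ((\<lambda>\<omega>. \<omega> (Suc n)) -` {snd e} \<inter> space ?R))"
      by (force simp: spR)
    also have "\<dots> \<in> sets ?R"
      using countable_subset[OF that cE] by (intro sets.countable_UN' sets.Int measurable_sets[OF coord]) auto
    finally show ?thesis .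
  qed
  define g where "g n \<omega> = (if (\<omega> n, \<omega> (Suc n)) \<in> edges M then ereal (reward M (\<omega> n, \<omega> (Suc n))) else 0)"
    for n and \<omega> :: "nat \<Rightarrow> 'a"
  have g[measurable]: "g n \<in> borel_measurable ?R" for n
  proof (rule measurableI)
    fix B :: "ereal set" assume "B \<in> sets borel"
    have "g n -` B \<inter> space ?R =
       {\<omega>. (\<omega> n, \<omega> (Suc n)) \<in> {e \<in> edges M. ereal (reward M e) \<in> B}} \<union>
       (if 0 \<in> B then space ?R - {\<omega>. (\<omega> n, \<omega> (Suc n)) \<in> edges M} else {})"
      by (auto simp: g_def spR split: if_splits)
    also have "\<dots> \<in> sets ?R"
      using E[of "{e \<in> edges M. ereal (reward M e) \<in> B}" n] E[of "edges M" n]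
      by (auto intro!: sets.Un sets.compl_sets)
    finally show "g n -` B \<inter> space ?R \<in> sets ?R" .
  qed simp
  have "runs M = (\<Inter>n. {\<omega>. (\<omega> n, \<omega> (Suc n)) \<in> edges M})"
    using M unfolding runs_def countable_mdp_def by blast
  also have "\<dots> \<in> sets ?R"
    by (intro sets.countable_INT'') (auto intro: E simp: spR[symmetric])
  finally have runs: "runs M \<in> sets ?R" .
  have "(\<lambda>\<omega>. liminf (\<lambda>n. g n \<omega>)) \<in> borel_measurable ?R"
    by measurable
  then have "(\<lambda>\<omega>. liminf (\<lambda>n. g n \<omega>)) -` {0..} \<inter> space ?R \<in> sets ?R"
    by (rule measurable_sets) simp
  moreover have "PP_liminf_nonneg M = runs M \<inter> ((\<lambda>\<omega>. liminf (\<lambda>n. g n \<omega>)) -` {0..} \<inter> space ?R)"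
    by (auto simp: PP_liminf_nonneg_def runs_def g_def spR)
  ultimately show ?thesis
    using runs by simp
qed

text \<open>The supremum defining \<open>value_of\<close> ranges over a nonempty bounded set.\<close>

lemma value_of_well_defined:
  assumes "countable_mdp M"
  shows "{\<sigma>. strategy M \<sigma>} \<noteq> {}"
    and "bdd_above ((\<lambda>\<sigma>. measure (run_measure M \<sigma> s) \<phi>) ` {\<sigma>. strategy M \<sigma>})"
proof -
  show "{\<sigma>. strategy M \<sigma>} \<noteq> {}"
    using strategy_exists[OF assms] by blast
  have "measure (run_measure M \<sigma> s) \<phi> \<le> 1" for \<sigma>
    using assms by (intro prob_space.prob_le_1 prob_space_run_measure) (unfold countable_mdp_def, blast)
  then show "bdd_above ((\<lambda>\<sigma>. measure (run_measure M \<sigma> s) \<phi>) ` {\<sigma>. strategy M \<sigma>})"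
    by (auto intro!: bdd_aboveI[of _ 1])
qed

end

theory Submission
  imports Defs
begin

text \<open>Fix a nearly optimal strategy \<open>\<sigma>\<close>. By continuity of measure there are times \<open>m i\<close> such that,
  up to a small loss of probability, all rewards from step \<open>m i\<close> on are at least \<open>- 1 / (i + 1)\<close>,
  for all \<open>i\<close> simultaneously. This is a safety objective with a step-dependent set of safe
  transitions, contained in the original objective. Let \<open>u n t\<close> be the supremum, over the partial
  runs with \<open>n\<close> steps ending in \<open>t\<close>, of the conditional probability under \<open>\<sigma>\<close> of being safe. It is
  dominated by its one-step Bellman update, so at step \<open>n\<close> in a controlled state some successor
  loses at most \<open>\<delta> n\<close>. Since the losses are indexed by the step counter they are summable, and
  the deterministic choice of such successors is safe with probability at least
  \<open>u 0 s - (\<Sum>n. \<delta> n)\<close>, even though suprema over infinitely many successors need not be attained.\<close>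

section \<open>Partial runs and their cylinder events\<close>

lemma partial_run_snoc_iff:
  assumes "countable_mdp M" "h \<noteq> []"
  shows "partial_run M (h @ [t]) \<longleftrightarrow> partial_run M h \<and> (last h, t) \<in> edges M"
proof
  assume *: "partial_run M (h @ [t])"
  have "(h ! i, h ! Suc i) \<in> edges M" if "Suc i < length h" for i
    using * that unfolding partial_run_def by (auto simp: nth_append dest!: spec[of _ i])
  moreover have "(last h, t) \<in> edges M"
    using * assms(2) unfolding partial_run_def
    by (auto simp: nth_append last_conv_nth dest!: spec[of _ "length h - 1"] split: if_splits)
  ultimately show "partial_run M h \<and> (last h, t) \<in> edges M"
    using * assms(2) unfolding partial_run_def by auto
next
  assume *: "partial_run M h \<and> (last h, t) \<in> edges M"
  have "((h @ [t]) ! i, (h @ [t]) ! Suc i) \<in> edges M" if "Suc i < length (h @ [t])" for i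
  proof (cases "Suc i = length h")
    case True
    then have "i = length h - 1" "i < length h" by auto
    then show ?thesis
      using * assms(2) True by (simp add: nth_append last_conv_nth)
  next
    case False
    then show ?thesis
      using * that unfolding partial_run_def by (simp add: nth_append)
  qed
  moreover have "t \<in> states M"
    using * assms(1) unfolding countable_mdp_def by blast
  ultimately show "partial_run M (h @ [t])"
    using * unfolding partial_run_def by auto
qed

lemma partial_run_prefix_of_run:
  assumes "\<omega> \<in> runs M"
  shows "partial_run M (map \<omega> [0..<Suc n])"
  using assms unfolding runs_def partial_run_def by (auto simp del: upt_Suc)

lemma set_pmf_next_distr:
  assumes "countable_mdp M" "strategy M \<sigma>" "partial_run M h"
  shows "set_pmf (next_distr M \<sigma> h) \<subseteq> {t. (last h, t) \<in> edges M}"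
proof -
  have "last h \<in> states M"
    using assms(3) unfolding partial_run_def by auto
  then show ?thesis
    using assms unfolding next_distr_def strategy_def countable_mdp_def by (auto split: if_splits)
qed

text \<open>The state type may be uncountable, but only countably many lists over
  \<open>states M\<close> exist, so the event is a countable union of cylinders, each a finite
  intersection of coordinate events.\<close>

lemma prefix_set_in_sets_run_measure:
  assumes ctbl: "countable (states M)" and X: "X \<subseteq> lists (states M)"
  shows "{\<omega>. map \<omega> [0..<n] \<in> X} \<in> sets (run_measure M \<sigma> s)"
proof -
  let ?R = "run_measure M \<sigma> s"
  have spR: "space ?R = UNIV" by (rule space_run_measure[OF ctbl])
  have coord: "(\<lambda>\<omega>. \<omega> i) \<in> measurable ?R (count_space UNIV)" for i
    unfolding measurable_cong_sets[OF sets_run_measure[OF ctbl] refl]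
    by (rule measurable_component_singleton) simp
  have cyl: "{\<omega>. \<forall>i<n. \<omega> i = h ! i} \<in> sets ?R" for h
  proof -
    have "{\<omega>. \<omega> i = h ! i} \<in> sets ?R" for i
      using measurable_sets[OF coord[of i], of "{h ! i}"] by (simp add: spR vimage_def)
    moreover have "{\<omega>. \<forall>i<n. \<omega> i = h ! i} = space ?R \<inter> (\<Inter>i\<in>{..<n}. {\<omega>. \<omega> i = h ! i})"
      by (auto simp: spR)
    ultimately show ?thesis
      using sets.top[of ?R] by (cases "n = 0") (simp_all add: spR sets.finite_INT lessThan_empty_iff)
  qed
  have "countable {h\<in>X. length h = n}"
    by (rule countable_subset[OF _ countable_lists[OF ctbl]]) (use X in auto)
  then have "(\<Union>h\<in>{h\<in>X. length h = n}. {\<omega>. \<forall>i<n. \<omega> i = h ! i}) \<in> sets ?R"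
    using cyl by (intro sets.countable_UN') auto
  moreover have "{\<omega>. map \<omega> [0..<n] \<in> X} =
      (\<Union>h\<in>{h\<in>X. length h = n}. {\<omega>. \<forall>i<n. \<omega> i = h ! i})"
  proof (intro set_eqI iffI)
    fix \<omega> assume "\<omega> \<in> {\<omega>. map \<omega> [0..<n] \<in> X}"
    then show "\<omega> \<in> (\<Union>h\<in>{h\<in>X. length h = n}. {\<omega>. \<forall>i<n. \<omega> i = h ! i})"
      by (intro UN_I[of "map \<omega> [0..<n]"]) auto
  next
    fix \<omega> assume "\<omega> \<in> (\<Union>h\<in>{h\<in>X. length h = n}. {\<omega>. \<forall>i<n. \<omega> i = h ! i})"
    then obtain h where h: "h \<in> X" "length h = n" "\<forall>i<n. \<omega> i = h ! i" by blast
    then have "map \<omega> [0..<n] = h" using map_upt_eq_iff[of \<omega> h] by simp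
    then show "\<omega> \<in> {\<omega>. map \<omega> [0..<n] \<in> X}" using h by simp
  qed
  ultimately show ?thesis by simp
qed

definition prefix_cylinder :: "'s list \<Rightarrow> (nat \<Rightarrow> 's) set" where
  "prefix_cylinder h = {\<omega>. map \<omega> [0..<length h] = h}"

lemma prefix_cylinder_in_sets:
  assumes "countable (states M)" "set h \<subseteq> states M"
  shows "prefix_cylinder h \<in> sets (run_measure M \<sigma> s)"
  using prefix_set_in_sets_run_measure[OF assms(1), of "{h}" "length h"] assms(2)
  by (auto simp: prefix_cylinder_def)

lemma prefix_cylinder_snoc:
  "prefix_cylinder (h @ [t]) = {\<omega>. map \<omega> [0..<length h] = h \<and> \<omega> (length h) \<in> {t}}"
  by (auto simp: prefix_cylinder_def)

lemma emeasure_prefix_cylinder_snoc: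
  assumes "countable (states M)" "partial_run M h"
  shows "emeasure (run_measure M \<sigma> s) (prefix_cylinder (h @ [t])) =
    emeasure (run_measure M \<sigma> s) (prefix_cylinder h) * ennreal (pmf (next_distr M \<sigma> h) t)"
  using emeasure_run_measure_step[OF assms(1), of \<sigma> s h "{t}"] assms(2)
  by (simp only: prefix_cylinder_snoc if_True emeasure_pmf_single) (simp add: prefix_cylinder_def)


section \<open>Step-dependent safety objectives\<close>

text \<open>A transition is judged by its step number and its two endpoints, never by the earlier
  history. This is why bounds indexed by step and state can work later.\<close>

definition safety :: "'s mdp \<Rightarrow> (nat \<Rightarrow> 's \<Rightarrow> 's \<Rightarrow> bool) \<Rightarrow> (nat \<Rightarrow> 's) set" where
  "safety M safe = {\<omega> \<in> runs M. \<forall>n. safe n (\<omega> n) (\<omega> (Suc n))}"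

definition safe_prefixes :: "'s mdp \<Rightarrow> (nat \<Rightarrow> 's \<Rightarrow> 's \<Rightarrow> bool) \<Rightarrow> 's list set" where
  "safe_prefixes M safe = {h. partial_run M h \<and> (\<forall>k. Suc k < length h \<longrightarrow> safe k (h ! k) (h ! Suc k))}"

lemma safe_prefixes_subset_lists: "safe_prefixes M safe \<subseteq> lists (states M)"
  by (auto simp: safe_prefixes_def partial_run_def)

text \<open>A partial run \<open>h\<close> has already taken \<open>length h - 1\<close> steps, and
  this is also the index of the step appended to it.\<close>

lemma safe_prefixes_snoc_iff:
  assumes "countable_mdp M" "h \<noteq> []"
  shows "h @ [t] \<in> safe_prefixes M safe \<longleftrightarrow>
    h \<in> safe_prefixes M safe \<and> (last h, t) \<in> edges M \<and> safe (length h - 1) (last h) t"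
proof -
  have "(\<forall>k. Suc k < length (h @ [t]) \<longrightarrow> safe k ((h @ [t]) ! k) ((h @ [t]) ! Suc k)) \<longleftrightarrow>
      (\<forall>k. Suc k < length h \<longrightarrow> safe k (h ! k) (h ! Suc k)) \<and> safe (length h - 1) (last h) t"
    (is "?L \<longleftrightarrow> ?R")
  proof
    assume L: ?L
    have "safe k (h ! k) (h ! Suc k)" if "Suc k < length h" for k
      using L that by (auto simp: nth_append dest!: spec[of _ k])
    moreover have "safe (length h - 1) (last h) t"
      using spec[OF L, of "length h - 1"] assms(2) by (simp add: nth_append last_conv_nth)
    ultimately show ?R by blast
  next
    assume R: ?R
    show ?L
    proof (intro allI impI)
      fix k assume k: "Suc k < length (h @ [t])"
      show "safe k ((h @ [t]) ! k) ((h @ [t]) ! Suc k)"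
      proof (cases "Suc k = length h")
        case True
        then have "k = length h - 1" "k < length h" by auto
        then show ?thesis using R True assms(2) by (simp add: nth_append last_conv_nth)
      next
        case False
        then show ?thesis using R k by (simp add: nth_append)
      qed
    qed
  qed
  then show ?thesis
    unfolding safe_prefixes_def using partial_run_snoc_iff[OF assms] by auto
qed

text \<open>Expressing safety through finite prefixes gives its measurability, and later continuity
  from above along the horizon.\<close>

lemma safety_eq_INT:
  assumes "countable_mdp M"
  shows "safety M safe = (\<Inter>n. {\<omega>. map \<omega> [0..<Suc n] \<in> safe_prefixes M safe})"
proof (intro set_eqI iffI)
  fix \<omega> assume "\<omega> \<in> safety M safe"
  then show "\<omega> \<in> (\<Inter>n. {\<omega>. map \<omega> [0..<Suc n] \<in> safe_prefixes M safe})"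
    using partial_run_prefix_of_run[of \<omega> M]
    by (auto simp: safety_def safe_prefixes_def simp del: upt_Suc)
next
  fix \<omega> assume *: "\<omega> \<in> (\<Inter>n. {\<omega>. map \<omega> [0..<Suc n] \<in> safe_prefixes M safe})"
  have "(\<omega> n, \<omega> (Suc n)) \<in> edges M \<and> safe n (\<omega> n) (\<omega> (Suc n))" for n
  proof -
    have "map \<omega> [0..<Suc (Suc n)] \<in> safe_prefixes M safe" using * by blast
    then show ?thesis
      unfolding safe_prefixes_def partial_run_def
      by (auto simp del: upt_Suc dest!: spec[of _ n])
  qed
  then show "\<omega> \<in> safety M safe"
    using assms unfolding safety_def runs_def countable_mdp_def by blast
qed

lemma safety_in_sets:
  assumes "countable_mdp M"
  shows "safety M safe \<in> sets (run_measure M \<sigma> s)"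
proof -
  have ctbl: "countable (states M)" using assms unfolding countable_mdp_def by blast
  show ?thesis
    unfolding safety_eq_INT[OF assms]
    using prefix_set_in_sets_run_measure[OF ctbl safe_prefixes_subset_lists]
    by (intro sets.countable_INT) (auto simp del: upt_Suc)
qed


section \<open>Conditional safety probabilities\<close>

definition cond_safety :: "'s mdp \<Rightarrow> ('s list \<Rightarrow> 's pmf) \<Rightarrow> 's \<Rightarrow>
    (nat \<Rightarrow> 's \<Rightarrow> 's \<Rightarrow> bool) \<Rightarrow> 's list \<Rightarrow> ennreal" where
  "cond_safety M \<sigma> s safe h =
     emeasure (run_measure M \<sigma> s) (safety M safe \<inter> prefix_cylinder h) /
     emeasure (run_measure M \<sigma> s) (prefix_cylinder h)"

text \<open>\<open>cond_safety\<close> is \<open>0 / 0 = 0\<close> for histories of probability 0, and the supremum over the empty set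
  of histories is \<open>0\<close> in \<^typ>\<open>ennreal\<close>, so unreachable states do no harm below.\<close>

definition best_cond_safety :: "'s mdp \<Rightarrow> ('s list \<Rightarrow> 's pmf) \<Rightarrow> 's \<Rightarrow>
    (nat \<Rightarrow> 's \<Rightarrow> 's \<Rightarrow> bool) \<Rightarrow> nat \<Rightarrow> 's \<Rightarrow> ennreal" where
  "best_cond_safety M \<sigma> s safe n t =
     (SUP h\<in>{h. partial_run M h \<and> length h = Suc n \<and> last h = t}. cond_safety M \<sigma> s safe h)"

text \<open>On a null cylinder both sides of the identity vanish, so the product rule holds for all
  partial runs, including those of probability 0.\<close>

lemma cond_safety_mult:
  assumes "countable_mdp M" "partial_run M h"
  shows "emeasure (run_measure M \<sigma> s) (safety M safe \<inter> prefix_cylinder h) =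
    cond_safety M \<sigma> s safe h * emeasure (run_measure M \<sigma> s) (prefix_cylinder h)"
    and "cond_safety M \<sigma> s safe h \<le> 1"
proof -
  let ?R = "run_measure M \<sigma> s"
  have ctbl: "countable (states M)" using assms unfolding countable_mdp_def by blast
  interpret prob_space ?R by (rule prob_space_run_measure[OF ctbl])
  have "set h \<subseteq> states M" using assms(2) by (simp add: partial_run_def)
  then have le: "emeasure ?R (safety M safe \<inter> prefix_cylinder h) \<le> emeasure ?R (prefix_cylinder h)"
    by (intro emeasure_mono prefix_cylinder_in_sets[OF ctbl]) auto
  have fin: "emeasure ?R (prefix_cylinder h) \<noteq> \<top>"
    by simp
  show "emeasure ?R (safety M safe \<inter> prefix_cylinder h) =
      cond_safety M \<sigma> s safe h * emeasure ?R (prefix_cylinder h)"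
  proof (cases "emeasure ?R (prefix_cylinder h) = 0")
    case True
    then show ?thesis using le by simp
  next
    case False
    then show ?thesis
      unfolding cond_safety_def ennreal_divide_times
      by (subst ennreal_divide_self) (use fin in \<open>auto simp: less_top[symmetric]\<close>)
  qed
  show "cond_safety M \<sigma> s safe h \<le> 1"
  proof (cases "emeasure ?R (prefix_cylinder h) = 0")
    case True
    then show ?thesis using le by (simp add: cond_safety_def)
  next
    case False
    then show ?thesis
      unfolding cond_safety_def using le fin
      by (metis divide_right_mono_ennreal ennreal_divide_self top.not_eq_extremum)
  qed
qed

lemma best_cond_safety_le_1:
  assumes "countable_mdp M"
  shows "best_cond_safety M \<sigma> s safe n t \<le> 1"
  unfolding best_cond_safety_def using cond_safety_mult(2)[OF assms] by (intro SUP_least) auto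

text \<open>Runs start in \<open>s\<close> almost surely, so conditioning on the one-state history
  \<open>[s]\<close> changes nothing.\<close>

lemma emeasure_safety_le_best_cond_safety:
  assumes M: "countable_mdp M" and s: "s \<in> states M" and \<sigma>: "strategy M \<sigma>"
  shows "emeasure (run_measure M \<sigma> s) (safety M safe) \<le> best_cond_safety M \<sigma> s safe 0 s"
proof -
  let ?R = "run_measure M \<sigma> s"
  have ctbl: "countable (states M)" using assms unfolding countable_mdp_def by blast
  have [measurable]: "safety M safe \<in> sets ?R" by (rule safety_in_sets[OF M])
  have [measurable]: "prefix_cylinder [s] \<in> sets ?R"
    using s by (intro prefix_cylinder_in_sets[OF ctbl]) auto
  have cyl: "prefix_cylinder [s] = {\<omega>. \<omega> 0 = s}" by (auto simp: prefix_cylinder_def)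
  have "emeasure ?R (safety M safe) = emeasure ?R (safety M safe \<inter> prefix_cylinder [s])"
  proof (rule emeasure_eq_AE)
    show "AE \<omega> in ?R. \<omega> \<in> safety M safe \<longleftrightarrow> \<omega> \<in> safety M safe \<inter> prefix_cylinder [s]"
      using AE_runs[OF M s \<sigma>] by eventually_elim (auto simp: cyl)
  qed measurable
  also have "\<dots> = cond_safety M \<sigma> s safe [s]"
    unfolding cond_safety_def
    by (simp add: cyl emeasure_run_measure_init[OF ctbl] divide_ennreal_def)
  also have "\<dots> \<le> best_cond_safety M \<sigma> s safe 0 s"
    unfolding best_cond_safety_def using s by (intro SUP_upper) (auto simp: partial_run_def)
  finally show ?thesis .
qed

text \<open>Split the cylinder of \<open>h\<close> by the next state \<open>t\<close>. The piece for
  \<open>t\<close> contributes only if the step to \<open>t\<close> is safe, and its conditional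
  safety is at most the supremum over all histories of that length ending in \<open>t\<close>.
  Dividing by the probability of the cylinder gives the one-step update.\<close>

lemma cond_safety_step:
  assumes M: "countable_mdp M" and h: "partial_run M h" "length h = Suc n"
  shows "cond_safety M \<sigma> s safe h \<le>
    (\<integral>\<^sup>+t. indicator {t. safe n (last h) t} t * best_cond_safety M \<sigma> s safe (Suc n) t
      \<partial>measure_pmf (next_distr M \<sigma> h))"
proof -
  let ?R = "run_measure M \<sigma> s" and ?A = "safety M safe"
  let ?p = "next_distr M \<sigma> h"
  let ?g = "\<lambda>t. indicator {t. safe n (last h) t} t * best_cond_safety M \<sigma> s safe (Suc n) t"
  let ?c = "emeasure ?R (prefix_cylinder h)"
  have ctbl: "countable (states M)" using assms unfolding countable_mdp_def by blast
  interpret prob_space ?R by (rule prob_space_run_measure[OF ctbl])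
  have ne: "h \<noteq> []" and hs: "set h \<subseteq> states M" using h by (auto simp: partial_run_def)
  have bound: "emeasure ?R (?A \<inter> prefix_cylinder (h @ [t])) \<le> ?c * (ennreal (pmf ?p t) * ?g t)" for t
  proof (cases "?A \<inter> prefix_cylinder (h @ [t]) = {}")
    case False
    then obtain \<omega> where \<omega>: "\<omega> \<in> ?A" "map \<omega> [0..<Suc (Suc n)] = h @ [t]"
      using h(2) by (auto simp: prefix_cylinder_def simp del: upt_Suc)
    \<comment> \<open>A nonempty piece contains a safe run, which certifies that
      \<open>h @ [t]\<close> is a partial run whose last step is safe.\<close>
    then have "h @ [t] \<in> safe_prefixes M safe"
      using safety_eq_INT[OF M, of safe] by (metis (no_types, lifting) INT_E UNIV_I mem_Collect_eq)
    then have safe: "safe n (last h) t" and run: "partial_run M (h @ [t])"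
      using safe_prefixes_snoc_iff[OF M ne, of t safe] h(2) by (auto simp: safe_prefixes_def)
    have "emeasure ?R (?A \<inter> prefix_cylinder (h @ [t])) =
        cond_safety M \<sigma> s safe (h @ [t]) * (?c * ennreal (pmf ?p t))"
      using cond_safety_mult(1)[OF M run] emeasure_prefix_cylinder_snoc[OF ctbl h(1)] by simp
    also have "\<dots> \<le> best_cond_safety M \<sigma> s safe (Suc n) t * (?c * ennreal (pmf ?p t))"
      unfolding best_cond_safety_def using run h(2) by (intro mult_right_mono SUP_upper) auto
    finally show ?thesis using safe by (simp add: mult_ac)
  qed simp
  have sets: "?A \<inter> prefix_cylinder (h @ [t]) \<in> events" if "t \<in> states M" for t
    using that hs by (intro sets.Int safety_in_sets[OF M] prefix_cylinder_in_sets[OF ctbl]) auto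
  \<comment> \<open>Safe runs visit only elements of \<open>states M\<close>, which keeps this
    disjoint union countable.\<close>
  have split: "?A \<inter> prefix_cylinder h = (\<Union>t\<in>states M. ?A \<inter> prefix_cylinder (h @ [t]))"
    unfolding prefix_cylinder_snoc
    by (auto simp: prefix_cylinder_def safety_def runs_def)
  have "emeasure ?R (?A \<inter> prefix_cylinder h) =
      (\<integral>\<^sup>+t. emeasure ?R (?A \<inter> prefix_cylinder (h @ [t])) \<partial>count_space (states M))"
    unfolding split
    by (rule emeasure_UN_countable[OF sets ctbl])
       (auto simp: disjoint_family_on_def prefix_cylinder_def)
  also have "\<dots> \<le> (\<integral>\<^sup>+t. ?c * (ennreal (pmf ?p t) * ?g t) \<partial>count_space (states M))"
    by (intro nn_integral_mono bound)
  also have "\<dots> = ?c * (\<integral>\<^sup>+t. ennreal (pmf ?p t) * ?g t \<partial>count_space (states M))"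
    by (rule nn_integral_cmult) simp
  also have "\<dots> \<le> ?c * (\<integral>\<^sup>+t. ennreal (pmf ?p t) * ?g t \<partial>count_space UNIV)"
    by (intro mult_left_mono) (auto simp: nn_integral_count_space_indicator intro!: nn_integral_mono
        split: split_indicator)
  also have "(\<integral>\<^sup>+t. ennreal (pmf ?p t) * ?g t \<partial>count_space UNIV) = (\<integral>\<^sup>+t. ?g t \<partial>measure_pmf ?p)"
    by (rule nn_integral_measure_pmf[symmetric])
  finally have le: "emeasure ?R (?A \<inter> prefix_cylinder h) \<le> ?c * (\<integral>\<^sup>+t. ?g t \<partial>measure_pmf ?p)" .
  show ?thesis
  proof (cases "?c = 0")
    case True
    then show ?thesis using le by (simp add: cond_safety_def)
  next
    case False
    have "cond_safety M \<sigma> s safe h \<le> (?c * (\<integral>\<^sup>+t. ?g t \<partial>measure_pmf ?p)) / ?c"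
      unfolding cond_safety_def by (rule divide_right_mono_ennreal[OF le])
    also have "\<dots> = (\<integral>\<^sup>+t. ?g t \<partial>measure_pmf ?p)"
      using False by (simp add: mult.commute[of ?c] ennreal_mult_divide_eq)
    finally show ?thesis .
  qed
qed

text \<open>At a random state the next distribution is the same for every history, so the update
  bounds all histories at once and nothing is lost.\<close>

lemma best_cond_safety_random:
  assumes M: "countable_mdp M" and t: "t \<notin> controlled M"
  shows "best_cond_safety M \<sigma> s safe n t \<le>
    (\<integral>\<^sup>+t'. indicator {t'. safe n t t'} t' * best_cond_safety M \<sigma> s safe (Suc n) t'
      \<partial>measure_pmf (step_prob M t))"
  unfolding best_cond_safety_def[of M \<sigma> s safe n t]
proof (rule SUP_least)
  fix h assume "h \<in> {h. partial_run M h \<and> length h = Suc n \<and> last h = t}"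
  then show "cond_safety M \<sigma> s safe h \<le>
    (\<integral>\<^sup>+t'. indicator {t'. safe n t t'} t' * best_cond_safety M \<sigma> s safe (Suc n) t'
      \<partial>measure_pmf (step_prob M t))"
    using cond_safety_step[OF M, of h n \<sigma> s safe] t by (auto simp: next_distr_def)
qed

text \<open>If every successor fell short by more than \<delta>, then so would every average over
  successors, whatever \<open>\<sigma>\<close> chooses after a history ending in \<open>t\<close>.
  All conditional safeties would be at most \<open>?u n t - ennreal \<delta>\<close>, contradicting
  that \<open>?u n t\<close> is their least upper bound.\<close>

lemma best_cond_safety_controlled:
  assumes M: "countable_mdp M" and \<sigma>: "strategy M \<sigma>" and t: "t \<in> controlled M" and \<delta>: "\<delta> > 0"
  shows "\<exists>t'. (t, t') \<in> edges M \<and>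
    best_cond_safety M \<sigma> s safe n t \<le>
      indicator {t'. safe n t t'} t' * best_cond_safety M \<sigma> s safe (Suc n) t' + ennreal \<delta>"
proof (rule ccontr)
  let ?u = "best_cond_safety M \<sigma> s safe"
  let ?g = "\<lambda>t'. indicator {t'. safe n t t'} t' * ?u (Suc n) t' :: ennreal"
  assume "\<not> ?thesis"
  then have less: "?g t' + ennreal \<delta> < ?u n t" if "(t, t') \<in> edges M" for t'
    using that by (meson not_le)
  \<comment> \<open>The existence of a successor forces \<open>?u n t\<close> to be positive.
    Subtraction in \<open>ennreal\<close> is truncated at 0, so only then does subtracting \<delta>
    strictly decrease it.\<close>
  obtain t\<^sub>1 where t\<^sub>1: "(t, t\<^sub>1) \<in> edges M"
    using M t unfolding countable_mdp_def by blast
  have \<delta>_le: "ennreal \<delta> \<le> ?u n t"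
    using less[OF t\<^sub>1] by (metis add.commute add_increasing2 le_less zero_le order_le_less_trans)
  have fin: "?u n t < \<top>"
    using best_cond_safety_le_1[OF M, of \<sigma> s safe n t] by (meson ennreal_one_less_top order_le_less_trans)
  have "?u n t \<le> ?u n t - ennreal \<delta>"
    unfolding best_cond_safety_def[of M \<sigma> s safe n t]
  proof (rule SUP_least, fold best_cond_safety_def[of M \<sigma> s safe n t])
    fix h assume "h \<in> {h. partial_run M h \<and> length h = Suc n \<and> last h = t}"
    then have h: "partial_run M h" "length h = Suc n" "last h = t" by auto
    have "cond_safety M \<sigma> s safe h \<le> (\<integral>\<^sup>+t'. ?g t' \<partial>measure_pmf (next_distr M \<sigma> h))"
      using cond_safety_step[OF M h(1,2), of \<sigma> s safe] h(3) by simp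
    also have "\<dots> \<le> (\<integral>\<^sup>+t'. (?u n t - ennreal \<delta>) \<partial>measure_pmf (next_distr M \<sigma> h))"
    proof (rule nn_integral_mono_AE, rule AE_pmfI)
      fix t' assume "t' \<in> set_pmf (next_distr M \<sigma> h)"
      then have "?g t' + ennreal \<delta> < ?u n t"
        using set_pmf_next_distr[OF M \<sigma> h(1)] h(3) by (intro less) auto
      then show "?g t' \<le> ?u n t - ennreal \<delta>"
        by (metis add.commute ennreal_le_minus_iff ennreal_less_top le_less order.strict_implies_order)
    qed
    also have "\<dots> = ?u n t - ennreal \<delta>" by (simp add: measure_pmf.emeasure_space_1[simplified])
    finally show "cond_safety M \<sigma> s safe h \<le> ?u n t - ennreal \<delta>" .
  qed
  moreover have "?u n t - ennreal \<delta> < ?u n t"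
    using fin \<delta> \<delta>_le by (intro ennreal_between) (auto intro: less_le_trans[of _ "ennreal \<delta>"])
  ultimately show False by simp
qed


section \<open>Lower bounds for safety probabilities\<close>

text \<open>The law of the first \<open>n\<close> steps as a discrete distribution: expectations
  over histories become nested integrals in which every integrand is measurable.\<close>

primrec history_pmf :: "'s mdp \<Rightarrow> ('s list \<Rightarrow> 's pmf) \<Rightarrow> 's \<Rightarrow> nat \<Rightarrow> 's list pmf" where
  "history_pmf M \<sigma> s 0 = return_pmf [s]"
| "history_pmf M \<sigma> s (Suc n) =
     bind_pmf (history_pmf M \<sigma> s n) (\<lambda>h. map_pmf (\<lambda>t. h @ [t]) (next_distr M \<sigma> h))"

lemma history_pmf_support:
  "h \<in> set_pmf (history_pmf M \<sigma> s n) \<Longrightarrow> length h = Suc n \<and> hd h = s"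
proof (induction n arbitrary: h)
  case (Suc n)
  then obtain g t where "g \<in> set_pmf (history_pmf M \<sigma> s n)" "h = g @ [t]" by auto
  with Suc.IH[of g] show ?case by (cases g) auto
qed simp

text \<open>Both sides obey the same recursion on partial runs. Elsewhere they may differ, since
  \<open>step_kernel\<close> falls back to a point mass while \<open>history_pmf\<close> continues
  with \<open>next_distr\<close>.\<close>

lemma emeasure_prefix_cylinder_eq_history_pmf:
  assumes M: "countable_mdp M" and h: "partial_run M h" "length h = Suc n"
  shows "emeasure (run_measure M \<sigma> s) (prefix_cylinder h) = ennreal (pmf (history_pmf M \<sigma> s n) h)"
  using h
proof (induction n arbitrary: h)
  case 0
  then obtain t where t: "h = [t]" by (metis length_Suc_conv length_0_conv)
  have "countable (states M)" using M unfolding countable_mdp_def by blast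
  moreover have "prefix_cylinder h = {\<omega>. \<omega> 0 = t}" by (auto simp: t prefix_cylinder_def)
  ultimately show ?case
    using emeasure_run_measure_init[of M \<sigma> s t] by (auto simp: t)
next
  case (Suc n)
  have ctbl: "countable (states M)" using M unfolding countable_mdp_def by blast
  obtain g t where g: "h = g @ [t]" "length g = Suc n"
    using Suc.prems(2) by (metis length_Suc_conv_rev)
  then have ne: "g \<noteq> []" by auto
  then have run: "partial_run M g"
    using Suc.prems(1) partial_run_snoc_iff[OF M] g(1) by metis
  have "ennreal (pmf (history_pmf M \<sigma> s (Suc n)) h) =
      (\<integral>\<^sup>+g'. ennreal (pmf (map_pmf (\<lambda>t. g' @ [t]) (next_distr M \<sigma> g')) h) \<partial>history_pmf M \<sigma> s n)"
    by (simp add: ennreal_pmf_bind)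
  \<comment> \<open>Only the history \<open>g\<close> can be extended by one state to
    \<open>h\<close>, so the integrand is supported on \<open>{g}\<close>.\<close>
  also have "\<dots> = (\<integral>\<^sup>+g'. ennreal (pmf (next_distr M \<sigma> g) t) * indicator {g} g' \<partial>history_pmf M \<sigma> s n)"
  proof (rule nn_integral_cong)
    fix g'
    show "ennreal (pmf (map_pmf (\<lambda>t. g' @ [t]) (next_distr M \<sigma> g')) h) =
        ennreal (pmf (next_distr M \<sigma> g) t) * indicator {g} g'"
    proof (cases "g' = g")
      case True
      have "inj (\<lambda>t. g @ [t])" by (auto simp: inj_def)
      then have "pmf (map_pmf (\<lambda>t. g @ [t]) (next_distr M \<sigma> g)) (g @ [t]) = pmf (next_distr M \<sigma> g) t"
        by (rule pmf_map_inj')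
      then show ?thesis using True g(1) by simp
    next
      case False
      then have "h \<notin> set_pmf (map_pmf (\<lambda>t. g' @ [t]) (next_distr M \<sigma> g'))"
        using g(1) by auto
      then show ?thesis using False by (simp only: set_pmf_iff) simp
    qed
  qed
  also have "\<dots> = ennreal (pmf (next_distr M \<sigma> g) t) * ennreal (pmf (history_pmf M \<sigma> s n) g)"
    by (subst nn_integral_cmult_indicator) (auto simp: emeasure_pmf_single)
  finally show ?case
    using emeasure_prefix_cylinder_snoc[OF ctbl run, of \<sigma> s t] Suc.IH[OF run g(2)] g(1)
    by (simp add: mult.commute)
qed

text \<open>The mass of \<open>X\<close> sits on its members of length \<open>Suc n\<close>. These
  are countably many partial runs with disjoint cylinders, so the equality of point masses and
  cylinder probabilities can be summed.\<close>

lemma emeasure_history_pmf_le: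
  assumes M: "countable_mdp M" and X: "X \<subseteq> {h. partial_run M h}"
  shows "emeasure (measure_pmf (history_pmf M \<sigma> s n)) X \<le>
    emeasure (run_measure M \<sigma> s) {\<omega>. map \<omega> [0..<Suc n] \<in> X}"
proof -
  let ?R = "run_measure M \<sigma> s" and ?p = "history_pmf M \<sigma> s n"
  define Y where "Y = {h\<in>X. length h = Suc n}"
  have ctbl: "countable (states M)" using M unfolding countable_mdp_def by blast
  have XL: "X \<subseteq> lists (states M)" using X by (auto simp: partial_run_def)
  have Y: "countable Y"
    by (rule countable_subset[OF _ countable_lists[OF ctbl]]) (use XL in \<open>auto simp: Y_def\<close>)
  have sets: "prefix_cylinder h \<in> sets ?R" if "h \<in> Y" for h
    using that XL by (intro prefix_cylinder_in_sets[OF ctbl]) (auto simp: Y_def)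
  have "emeasure (measure_pmf ?p) X = emeasure (measure_pmf ?p) Y"
    by (rule emeasure_eq_AE) (auto simp: AE_measure_pmf_iff Y_def dest: history_pmf_support)
  also have "\<dots> = (\<integral>\<^sup>+h. emeasure (measure_pmf ?p) {h} \<partial>count_space Y)"
    by (rule emeasure_countable_singleton[OF _ Y]) simp
  also have "\<dots> = (\<integral>\<^sup>+h. emeasure ?R (prefix_cylinder h) \<partial>count_space Y)"
  proof (rule nn_integral_cong)
    fix h assume "h \<in> space (count_space Y)"
    then have "partial_run M h" "length h = Suc n" using X by (auto simp: Y_def)
    then show "emeasure (measure_pmf ?p) {h} = emeasure ?R (prefix_cylinder h)"
      using emeasure_prefix_cylinder_eq_history_pmf[OF M] by (simp add: emeasure_pmf_single)
  qed
  also have "\<dots> = emeasure ?R (\<Union>h\<in>Y. prefix_cylinder h)"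
    by (rule emeasure_UN_countable[OF sets Y, symmetric])
       (auto simp: disjoint_family_on_def prefix_cylinder_def Y_def simp del: upt_Suc)
  also have "\<dots> \<le> emeasure ?R {\<omega>. map \<omega> [0..<Suc n] \<in> X}"
    by (rule emeasure_mono[OF _ prefix_set_in_sets_run_measure[OF ctbl XL]])
       (auto simp: prefix_cylinder_def Y_def simp del: upt_Suc)
  finally show ?thesis .
qed

text \<open>Let \<open>\<Phi> n\<close> be the expected value of \<open>u\<close> at time
  \<open>n\<close>, restricted to histories that are safe so far. Each step loses at most
  \<open>\<delta> n\<close>, so telescoping bounds \<open>u 0 s\<close> by
  \<open>\<Phi> N + d\<close>. As \<open>u\<close> is at most 1, \<open>\<Phi> N\<close> is at most
  the probability of staying safe for \<open>N\<close> steps, which decreases to the probability of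
  safety.\<close>

lemma emeasure_safety_ge:
  fixes \<delta> :: "nat \<Rightarrow> ennreal"
  assumes M: "countable_mdp M" and s: "s \<in> states M" and \<pi>: "strategy M \<pi>"
    and u1: "\<And>n t. u n t \<le> 1"
    and step: "\<And>h n. partial_run M h \<Longrightarrow> hd h = s \<Longrightarrow> length h = Suc n \<Longrightarrow>
      u n (last h) \<le>
        (\<integral>\<^sup>+t. indicator {t. safe n (last h) t} t * u (Suc n) t \<partial>measure_pmf (next_distr M \<pi> h)) + \<delta> n"
    and \<delta>: "\<And>N. (\<Sum>n<N. \<delta> n) \<le> d"
  shows "u 0 s \<le> emeasure (run_measure M \<pi> s) (safety M safe) + d"
proof -
  let ?R = "run_measure M \<pi> s" and ?H = "safe_prefixes M safe"
  let ?p = "history_pmf M \<pi> s"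
  define \<Phi> where "\<Phi> n = (\<integral>\<^sup>+h. indicator ?H h * u n (last h) \<partial>measure_pmf (?p n))" for n
  have ctbl: "countable (states M)" using M unfolding countable_mdp_def by blast
  interpret prob_space ?R by (rule prob_space_run_measure[OF ctbl])
  have \<Phi>_step: "\<Phi> n \<le> \<Phi> (Suc n) + \<delta> n" for n
  proof -
    have "\<Phi> n \<le> (\<integral>\<^sup>+h. (\<integral>\<^sup>+t. indicator ?H (h @ [t]) * u (Suc n) t \<partial>measure_pmf (next_distr M \<pi> h)) + \<delta> n
        \<partial>measure_pmf (?p n))"
      unfolding \<Phi>_def
    proof (rule nn_integral_mono_AE, rule AE_pmfI)
      fix h assume "h \<in> set_pmf (?p n)"
      then have h: "length h = Suc n" "hd h = s" using history_pmf_support by fast+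
      show "indicator ?H h * u n (last h) \<le>
          (\<integral>\<^sup>+t. indicator ?H (h @ [t]) * u (Suc n) t \<partial>measure_pmf (next_distr M \<pi> h)) + \<delta> n"
      proof (cases "h \<in> ?H")
        case True
        then have run: "partial_run M h" by (simp add: safe_prefixes_def)
        have ne: "h \<noteq> []" using h(1) by auto
        have "(\<integral>\<^sup>+t. indicator {t. safe n (last h) t} t * u (Suc n) t \<partial>measure_pmf (next_distr M \<pi> h)) =
            (\<integral>\<^sup>+t. indicator ?H (h @ [t]) * u (Suc n) t \<partial>measure_pmf (next_distr M \<pi> h))"
        \<comment> \<open>On the support of the next distribution, \<open>t\<close> is a successor
          of \<open>last h\<close>, so extending the safe prefix \<open>h\<close> stays safe exactly
          when this one step is safe.\<close>
        proof (rule nn_integral_cong_AE, rule AE_pmfI)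
          fix t assume "t \<in> set_pmf (next_distr M \<pi> h)"
          then have "(last h, t) \<in> edges M" using set_pmf_next_distr[OF M \<pi> run] by auto
          then show "indicator {t. safe n (last h) t} t * u (Suc n) t = indicator ?H (h @ [t]) * u (Suc n) t"
            using True h(1) safe_prefixes_snoc_iff[OF M ne, of t safe] by (auto split: split_indicator)
        qed
        then show ?thesis using step[OF run h(2,1)] True by simp
      qed simp
    qed
    also have "\<dots> = (\<integral>\<^sup>+h. (\<integral>\<^sup>+t. indicator ?H (h @ [t]) * u (Suc n) t \<partial>measure_pmf (next_distr M \<pi> h))
        \<partial>measure_pmf (?p n)) + \<delta> n"
      by (subst nn_integral_add) (auto simp: measure_pmf.emeasure_space_1[simplified])
    also have "\<dots> = \<Phi> (Suc n) + \<delta> n"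
      by (simp add: \<Phi>_def nn_integral_bind_pmf)
    finally show ?thesis .
  qed
  have "u 0 s \<le> \<Phi> N + (\<Sum>n<N. \<delta> n)" for N
  proof (induction N)
    case 0
    have "[s] \<in> ?H" using s by (auto simp: safe_prefixes_def partial_run_def)
    then show ?case by (simp add: \<Phi>_def nn_integral_return_pmf)
  next
    case (Suc N)
    also have "\<Phi> N + (\<Sum>n<N. \<delta> n) \<le> (\<Phi> (Suc N) + \<delta> N) + (\<Sum>n<N. \<delta> n)"
      by (intro add_right_mono \<Phi>_step)
    finally show ?case by (simp add: add_ac)
  qed
  moreover have "\<Phi> N \<le> emeasure ?R {\<omega>. map \<omega> [0..<Suc N] \<in> ?H}" for N
  proof -
    have "\<Phi> N \<le> (\<integral>\<^sup>+h. indicator ?H h \<partial>measure_pmf (?p N))"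
      unfolding \<Phi>_def using u1 by (intro nn_integral_mono) (auto split: split_indicator)
    also have "\<dots> = emeasure (measure_pmf (?p N)) ?H" by simp
    also have "\<dots> \<le> emeasure ?R {\<omega>. map \<omega> [0..<Suc N] \<in> ?H}"
      by (rule emeasure_history_pmf_le[OF M]) (auto simp: safe_prefixes_def)
    finally show ?thesis .
  qed
  ultimately have "u 0 s \<le> emeasure ?R {\<omega>. map \<omega> [0..<Suc N] \<in> ?H} + d" for N
    using \<delta> by (meson add_mono order_trans)
  then have "u 0 s \<le> (INF N. emeasure ?R {\<omega>. map \<omega> [0..<Suc N] \<in> ?H} + d)"
    by (intro INF_greatest)
  also have "\<dots> = (INF N. emeasure ?R {\<omega>. map \<omega> [0..<Suc N] \<in> ?H}) + d"
    by (rule INF_ennreal_add_const)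
  also have "(INF N. emeasure ?R {\<omega>. map \<omega> [0..<Suc N] \<in> ?H}) =
      emeasure ?R (\<Inter>N. {\<omega>. map \<omega> [0..<Suc N] \<in> ?H})"
  proof (rule INF_emeasure_decseq)
    show "range (\<lambda>N. {\<omega>. map \<omega> [0..<Suc N] \<in> ?H}) \<subseteq> events"
      using prefix_set_in_sets_run_measure[OF ctbl safe_prefixes_subset_lists]
      by (auto simp del: upt_Suc)
    show "decseq (\<lambda>N. {\<omega>. map \<omega> [0..<Suc N] \<in> ?H})"
    proof (rule decseq_SucI, rule subsetI)
      fix N \<omega> assume "\<omega> \<in> {\<omega>. map \<omega> [0..<Suc (Suc N)] \<in> ?H}"
      then show "\<omega> \<in> {\<omega>. map \<omega> [0..<Suc N] \<in> ?H}"
        using safe_prefixes_snoc_iff[OF M, of "map \<omega> [0..<Suc N]" "\<omega> (Suc N)" safe] by simp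
    qed
  qed simp
  finally show ?thesis by (simp only: safety_eq_INT[OF M])
qed

text \<open>Only histories starting in \<open>s\<close> are constrained: in the step-counter MDP these are the ones whose
  length agrees with the counter, so that a memoryless strategy can follow a selector.\<close>

definition follows :: "'s mdp \<Rightarrow> 's \<Rightarrow> (nat \<Rightarrow> 's \<Rightarrow> 's) \<Rightarrow> ('s list \<Rightarrow> 's pmf) \<Rightarrow> bool" where
  "follows M s f \<pi> \<longleftrightarrow> strategy M \<pi> \<and>
     (\<forall>h. partial_run M h \<and> hd h = s \<and> last h \<in> controlled M \<longrightarrow>
        \<pi> h = return_pmf (f (length h - 1) (last h)))"

text \<open>The selector picks, at step \<open>n\<close>, a successor within
  \<open>\<delta> n\<close> of the best conditional safety. The losses \<open>\<delta> n\<close>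
  form a geometric budget of total at most \<epsilon>, and random states use none of it.\<close>

lemma safety_near_optimal_selector:
  assumes M: "countable_mdp M" and s: "s \<in> states M" and \<sigma>: "strategy M \<sigma>" and \<epsilon>: "\<epsilon> > 0"
  obtains f where "\<And>n t. t \<in> controlled M \<Longrightarrow> (t, f n t) \<in> edges M"
    and "\<And>\<pi>. follows M s f \<pi> \<Longrightarrow>
      measure (run_measure M \<pi> s) (safety M safe) \<ge> measure (run_measure M \<sigma> s) (safety M safe) - \<epsilon>"
proof -
  let ?u = "best_cond_safety M \<sigma> s safe"
  define \<delta> :: "nat \<Rightarrow> real" where "\<delta> n = \<epsilon> * (1/2) ^ Suc n" for n
  have \<delta>0: "\<delta> n > 0" for n using \<epsilon> by (simp add: \<delta>_def)
  have ctbl: "countable (states M)" using M unfolding countable_mdp_def by blast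
  have "\<forall>n t. \<exists>t'. t \<in> controlled M \<longrightarrow> (t, t') \<in> edges M \<and>
      ?u n t \<le> indicator {t'. safe n t t'} t' * ?u (Suc n) t' + ennreal (\<delta> n)"
    using best_cond_safety_controlled[OF M \<sigma> _ \<delta>0] by blast
  then obtain f where f: "\<And>n t. t \<in> controlled M \<Longrightarrow> (t, f n t) \<in> edges M"
    "\<And>n t. t \<in> controlled M \<Longrightarrow>
      ?u n t \<le> indicator {t'. safe n t t'} (f n t) * ?u (Suc n) (f n t) + ennreal (\<delta> n)"
    by metis
  have \<delta>_sum: "(\<Sum>n<N. ennreal (\<delta> n)) \<le> ennreal \<epsilon>" for N
  proof -
    have "(\<Sum>n<N. \<delta> n) = \<epsilon> * (1 - (1/2) ^ N)"
      by (induction N) (auto simp: \<delta>_def field_simps)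
    also have "\<dots> \<le> \<epsilon>" using \<epsilon> by simp
    finally show ?thesis
      using \<delta>0 by (subst sum_ennreal) (auto intro: less_imp_le ennreal_leI)
  qed
  show thesis
  proof (rule that[of f, OF f(1)])
    fix \<pi> assume "follows M s f \<pi>"
    then have \<pi>: "strategy M \<pi>"
      and det: "\<And>h. partial_run M h \<Longrightarrow> hd h = s \<Longrightarrow> last h \<in> controlled M \<Longrightarrow>
        \<pi> h = return_pmf (f (length h - 1) (last h))"
      by (auto simp: follows_def)
    have "emeasure (run_measure M \<sigma> s) (safety M safe) \<le> ?u 0 s"
      by (rule emeasure_safety_le_best_cond_safety[OF M s \<sigma>])
    also have "\<dots> \<le> emeasure (run_measure M \<pi> s) (safety M safe) + ennreal \<epsilon>"
    proof (rule emeasure_safety_ge[where u = ?u and \<delta> = "\<lambda>n. ennreal (\<delta> n)",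
          OF M s \<pi> best_cond_safety_le_1[OF M] _ \<delta>_sum])
      fix h n assume h: "partial_run M h" "hd h = s" "length h = Suc n"
      show "?u n (last h) \<le>
        (\<integral>\<^sup>+t. indicator {t. safe n (last h) t} t * ?u (Suc n) t \<partial>measure_pmf (next_distr M \<pi> h)) + ennreal (\<delta> n)"
      proof (cases "last h \<in> controlled M")
        case True
        then have "next_distr M \<pi> h = return_pmf (f n (last h))"
          using det[OF h(1,2) True] h(3) by (simp add: next_distr_def)
        then show ?thesis using f(2)[OF True, of n] by (simp add: nn_integral_return_pmf)
      next
        case False
        then have "?u n (last h) \<le>
          (\<integral>\<^sup>+t. indicator {t. safe n (last h) t} t * ?u (Suc n) t \<partial>measure_pmf (next_distr M \<pi> h))"
          using best_cond_safety_random[OF M False, of \<sigma> s safe n] by (simp add: next_distr_def)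
        then show ?thesis by (rule order_trans) simp
      qed
    qed
    finally have "ennreal (measure (run_measure M \<sigma> s) (safety M safe)) \<le>
        ennreal (measure (run_measure M \<pi> s) (safety M safe) + \<epsilon>)"
      using \<epsilon> prob_space.finite_measure[OF prob_space_run_measure[OF ctbl]]
      by (simp add: finite_measure.emeasure_eq_measure ennreal_plus[symmetric] del: ennreal_plus)
    then show "measure (run_measure M \<pi> s) (safety M safe) \<ge> measure (run_measure M \<sigma> s) (safety M safe) - \<epsilon>"
      using \<epsilon> by (simp add: ennreal_le_iff del: ennreal_plus)
  qed
qed


section \<open>Approximating the objective by safety objectives\<close>

text \<open>For each \<open>i\<close> the sets \<open>B i m\<close> increase with \<open>m\<close>
  and cover the objective, so some threshold \<open>m i\<close> loses less than
  \<open>\<epsilon> * (1/2) ^ Suc i\<close>. Intersecting over all \<open>i\<close> loses at most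
  \<epsilon> in total and forces the limit inferior to be nonnegative.\<close>

lemma PP_liminf_nonneg_inner_safety:
  assumes M: "countable_mdp M" and \<epsilon>: "\<epsilon> > 0"
  obtains safe where "safety M safe \<subseteq> PP_liminf_nonneg M"
    and "measure (run_measure M \<sigma> s) (safety M safe) \<ge> measure (run_measure M \<sigma> s) (PP_liminf_nonneg M) - \<epsilon>"
proof -
  let ?R = "run_measure M \<sigma> s" and ?P = "PP_liminf_nonneg M"
  have ctbl: "countable (states M)" using M unfolding countable_mdp_def by blast
  interpret prob_space ?R by (rule prob_space_run_measure[OF ctbl])
  define B where "B i m = safety M (\<lambda>k s t. m \<le> k \<longrightarrow> reward M (s, t) \<ge> - inverse (real (Suc i)))" for i m
  have [measurable]: "?P \<in> events" by (rule PP_liminf_nonneg_measurable[OF M])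
  have [measurable]: "B i m \<in> events" for i m unfolding B_def by (rule safety_in_sets[OF M])
  have B_mono: "B i m \<subseteq> B i m'" if "m \<le> m'" for i m m'
    using that by (auto simp: B_def safety_def)
  have PB: "\<exists>m. \<omega> \<in> B i m" if "\<omega> \<in> ?P" for \<omega> i
  proof -
    have "ereal (- inverse (real (Suc i))) < liminf (\<lambda>n. ereal (reward M (\<omega> n, \<omega> (Suc n))))"
      using that by (auto simp: PP_liminf_nonneg_def less_le_trans[of _ 0])
    then have "\<forall>\<^sub>F n in sequentially. ereal (- inverse (real (Suc i))) < ereal (reward M (\<omega> n, \<omega> (Suc n)))"
      by (rule less_LiminfD)
    then obtain m where "\<forall>n\<ge>m. - inverse (real (Suc i)) < reward M (\<omega> n, \<omega> (Suc n))"
      by (auto simp: eventually_sequentially)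
    then have "\<omega> \<in> B i m"
      using that by (auto simp: B_def safety_def PP_liminf_nonneg_def less_imp_le)
    then show ?thesis ..
  qed
  have "\<exists>m. prob (?P - B i m) < \<epsilon> * (1/2) ^ Suc i" for i
  proof -
    have "(\<lambda>m. prob (?P - B i m)) \<longlonglongrightarrow> prob (\<Inter>m. ?P - B i m)"
      by (rule finite_Lim_measure_decseq)
         (auto simp: decseq_def dest: subsetD[OF B_mono])
    moreover have "(\<Inter>m. ?P - B i m) = {}" using PB by blast
    ultimately have "(\<lambda>m. prob (?P - B i m)) \<longlonglongrightarrow> 0" by (simp only: measure_empty)
    then have "\<forall>\<^sub>F m in sequentially. prob (?P - B i m) < \<epsilon> * (1/2) ^ Suc i"
      using \<epsilon> by (intro order_tendstoD) auto
    then show ?thesis by (auto simp: eventually_sequentially)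
  qed
  then obtain m where m: "\<And>i. prob (?P - B i (m i)) < \<epsilon> * (1/2) ^ Suc i" by metis
  \<comment> \<open>The intersection of the sets \<open>B i (m i)\<close> is a single safety event:
    at step \<open>k\<close> all constraints with \<open>m i \<le> k\<close> apply together.\<close>
  define safe where "safe k s t \<longleftrightarrow> (\<forall>i. m i \<le> k \<longrightarrow> reward M (s, t) \<ge> - inverse (real (Suc i)))" for k s t
  have A: "safety M safe = (\<Inter>i. B i (m i))"
    by (auto simp: safety_def B_def safe_def)
  show thesis
  proof (rule that[of safe])
    show "safety M safe \<subseteq> ?P"
    proof
      fix \<omega> assume \<omega>: "\<omega> \<in> safety M safe"
      have "0 \<le> liminf (\<lambda>n. ereal (reward M (\<omega> n, \<omega> (Suc n))))"
        unfolding le_Liminf_iff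
      proof (intro allI impI)
        fix y :: ereal assume "y < 0"
        \<comment> \<open>As \<open>y\<close> may be minus infinity, a real \<open>r\<close>
          strictly between \<open>y\<close> and 0 is inserted. Level \<open>i\<close> is chosen so
          that its reward bound lies above \<open>r\<close>.\<close>
        then obtain r :: real where r: "y < ereal r" "r < 0"
          using ereal_dense2[of y 0] by (auto simp: zero_ereal_def)
        obtain i where i: "inverse (real (Suc i)) < - r"
          using reals_Archimedean[of "- r"] r(2) by auto
        have "y < ereal (reward M (\<omega> n, \<omega> (Suc n)))" if "n \<ge> m i" for n
        proof -
          have "r \<le> reward M (\<omega> n, \<omega> (Suc n))"
            using \<omega> that i unfolding safety_def safe_def
            by (smt (verit) mem_Collect_eq)
          then show ?thesis using r(1) by (metis ereal_less_eq(3) less_le_trans)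
        qed
        then show "\<forall>\<^sub>F n in sequentially. y < ereal (reward M (\<omega> n, \<omega> (Suc n)))"
          unfolding eventually_sequentially by blast
      qed
      then show "\<omega> \<in> ?P" using \<omega> by (auto simp: PP_liminf_nonneg_def safety_def)
    qed
    have geo: "(\<lambda>i. \<epsilon> * (1/2) ^ Suc i) sums \<epsilon>"
      using sums_mult[OF power_half_series, of \<epsilon>] by simp
    have summ: "summable (\<lambda>i. prob (?P - B i (m i)))"
      by (rule summable_comparison_test'[OF sums_summable[OF geo], of 0])
         (use m in \<open>auto intro: less_imp_le simp del: power_Suc\<close>)
    have "prob (?P - safety M safe) = prob (\<Union>i. ?P - B i (m i))"
      unfolding A by (rule arg_cong[of _ _ prob]) auto
    also have "\<dots> \<le> (\<Sum>i. prob (?P - B i (m i)))"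
      by (rule finite_measure_subadditive_countably[OF _ summ]) auto
    also have "\<dots> \<le> (\<Sum>i. \<epsilon> * (1/2) ^ Suc i)"
      using m by (intro suminf_le[OF _ summ sums_summable[OF geo]]) (auto intro: less_imp_le simp del: power_Suc)
    also have "\<dots> = \<epsilon>" using geo by (rule sums_unique[symmetric])
    finally have "prob (?P - safety M safe) \<le> \<epsilon>" .
    moreover have "prob (?P - safety M safe) \<ge> prob ?P - prob (safety M safe)"
    proof -
      have [measurable]: "safety M safe \<in> events" by (rule safety_in_sets[OF M])
      have "prob ?P \<le> prob ((?P - safety M safe) \<union> safety M safe)"
        by (intro finite_measure_mono) auto
      also have "\<dots> \<le> prob (?P - safety M safe) + prob (safety M safe)"
        by (rule measure_Un_le) auto
      finally show ?thesis by simp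
    qed
    ultimately show "prob (safety M safe) \<ge> prob ?P - \<epsilon>" by simp
  qed
qed

text \<open>The error splits into three thirds: approaching the value by some
  \<open>\<sigma>\<close>, replacing the objective by a safety event inside it, and replacing
  \<open>\<sigma>\<close> by the selector. The inclusion of the safety event carries the bound back
  to the objective.\<close>

lemma PP_liminf_nonneg_near_optimal_selector:
  assumes M: "countable_mdp M" and s: "s \<in> states M" and \<epsilon>: "\<epsilon> > 0"
  obtains f where "\<And>n t. t \<in> controlled M \<Longrightarrow> (t, f n t) \<in> edges M"
    and "\<And>\<pi>. follows M s f \<pi> \<Longrightarrow>
      eps_optimal M (PP_liminf_nonneg M) s \<epsilon> \<pi>"
proof -
  let ?P = "PP_liminf_nonneg M"
  have ctbl: "countable (states M)" using M unfolding countable_mdp_def by blast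
  have "value_of M ?P s - \<epsilon> / 3 < value_of M ?P s" using \<epsilon> by simp
  then obtain \<sigma> where \<sigma>: "strategy M \<sigma>"
    "value_of M ?P s - \<epsilon> / 3 < measure (run_measure M \<sigma> s) ?P"
    unfolding value_of_def
    using less_cSUP_iff[OF value_of_well_defined(1)[OF M] value_of_well_defined(2)[OF M, of s ?P]] by auto
  obtain safe where safe: "safety M safe \<subseteq> ?P"
    "measure (run_measure M \<sigma> s) (safety M safe) \<ge> measure (run_measure M \<sigma> s) ?P - \<epsilon> / 3"
    using PP_liminf_nonneg_inner_safety[OF M, of "\<epsilon> / 3"] \<epsilon> by (metis divide_pos_pos zero_less_numeral)
  obtain f where f: "\<And>n t. t \<in> controlled M \<Longrightarrow> (t, f n t) \<in> edges M"
    and opt: "\<And>\<pi>. follows M s f \<pi> \<Longrightarrow>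
      measure (run_measure M \<pi> s) (safety M safe) \<ge> measure (run_measure M \<sigma> s) (safety M safe) - \<epsilon> / 3"
    using safety_near_optimal_selector[OF M s \<sigma>(1), of "\<epsilon> / 3" safe] \<epsilon> by auto
  show thesis
  proof (rule that[of f, OF f])
    fix \<pi> assume \<pi>: "follows M s f \<pi>"
    have "measure (run_measure M \<pi> s) (safety M safe) \<le> measure (run_measure M \<pi> s) ?P"
      using prob_space.finite_measure[OF prob_space_run_measure[OF ctbl]]
      by (rule finite_measure.finite_measure_mono[OF _ safe(1) PP_liminf_nonneg_measurable[OF M]])
    then show "eps_optimal M ?P s \<epsilon> \<pi>"
      unfolding eps_optimal_def using opt[OF \<pi>] \<sigma>(2) safe(2) \<pi> by (simp add: follows_def)
  qed
qed

section \<open>From selectors to memoryless and Markov strategies\<close>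

text \<open>Every edge raises the counter by one. On histories starting at counter 0, the number of
  steps taken can therefore be read off the last state.\<close>

lemma step_counter_partial_run:
  assumes "partial_run (step_counter_mdp M) h" "i < length h"
  shows "snd (h ! i) = snd (hd h) + i"
  using assms(2)
proof (induction i)
  case 0
  then show ?case by (simp add: hd_conv_nth)
next
  case (Suc i)
  then have "(h ! i, h ! Suc i) \<in> edges (step_counter_mdp M)"
    using assms(1) by (simp add: partial_run_def)
  with Suc show ?case by (auto simp: step_counter_mdp_def)
qed

theorem theorem3p10:
  fixes M :: "'s mdp" and s\<^sub>0 :: 's and \<epsilon> :: real
  assumes "countable_mdp M" and "s\<^sub>0 \<in> states M" and "\<epsilon> > 0"
  shows "(\<exists>\<sigma>. MD_strategy (step_counter_mdp M) \<sigma> \<and>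
            eps_optimal (step_counter_mdp M) (PP_liminf_nonneg (step_counter_mdp M)) (s\<^sub>0, 0) \<epsilon> \<sigma>) \<and>
         (\<exists>\<sigma>. det_Markov_strategy M \<sigma> \<and> eps_optimal M (PP_liminf_nonneg M) s\<^sub>0 \<epsilon> \<sigma>)"
proof
  let ?S = "step_counter_mdp M"
  have S: "countable_mdp ?S" by (rule countable_mdp_step_counter[OF assms(1)])
  have s: "(s\<^sub>0, 0) \<in> states ?S" using assms(2) by (simp add: step_counter_mdp_def)
  \<comment> \<open>The selector lemma is applied to the step-counter MDP itself. Its
    \<open>f\<close> still takes a step number as a separate argument, which the next choice
    replaces by the counter.\<close>
  obtain f where f: "\<And>n t. t \<in> controlled ?S \<Longrightarrow> (t, f n t) \<in> edges ?S"
    and opt: "\<And>\<pi>. follows ?S (s\<^sub>0, 0) f \<pi> \<Longrightarrow>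
      eps_optimal ?S (PP_liminf_nonneg ?S) (s\<^sub>0, 0) \<epsilon> \<pi>"
    using PP_liminf_nonneg_near_optimal_selector[OF S s assms(3)] by blast
  \<comment> \<open>This depends on the last state alone. It agrees with
    \<open>f (length h - 1)\<close> on histories from \<open>(s\<^sub>0, 0)\<close>, the only ones
    that \<open>follows\<close> constrains; histories with another initial counter may
    disagree.\<close>
  let ?\<sigma> = "\<lambda>h :: ('s \<times> nat) list. return_pmf (f (snd (last h)) (last h))"
  have strat: "strategy ?S ?\<sigma>"
    using f by (simp add: strategy_def)
  moreover have "eps_optimal ?S (PP_liminf_nonneg ?S) (s\<^sub>0, 0) \<epsilon> ?\<sigma>"
  proof (rule opt, unfold follows_def, intro conjI strat allI impI, elim conjE)
    fix h assume h: "partial_run ?S h" "hd h = (s\<^sub>0, 0)"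
    then have "h \<noteq> []" by (simp add: partial_run_def)
    then show "?\<sigma> h = return_pmf (f (length h - 1) (last h))"
      using step_counter_partial_run[OF h(1), of "length h - 1"] h(2) by (simp add: last_conv_nth)
  qed
  ultimately show "\<exists>\<sigma>. MD_strategy ?S \<sigma> \<and> eps_optimal ?S (PP_liminf_nonneg ?S) (s\<^sub>0, 0) \<epsilon> \<sigma>"
    unfolding MD_strategy_def by (intro exI[of _ ?\<sigma>]) (auto intro!: exI[of _ "\<lambda>t. f (snd t) t"])
next
  obtain f where f: "\<And>n t. t \<in> controlled M \<Longrightarrow> (t, f n t) \<in> edges M"
    and opt: "\<And>\<pi>. follows M s\<^sub>0 f \<pi> \<Longrightarrow>
      eps_optimal M (PP_liminf_nonneg M) s\<^sub>0 \<epsilon> \<pi>"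
    using PP_liminf_nonneg_near_optimal_selector[OF assms] by blast
  let ?\<sigma> = "\<lambda>h. return_pmf (f (length h - 1) (last h))"
  have "strategy M ?\<sigma>"
    using f by (simp add: strategy_def)
  then show "\<exists>\<sigma>. det_Markov_strategy M \<sigma> \<and> eps_optimal M (PP_liminf_nonneg M) s\<^sub>0 \<epsilon> \<sigma>"
    using opt[of ?\<sigma>] unfolding follows_def det_Markov_strategy_def by (intro exI[of _ ?\<sigma>]) auto
qed

end
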